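(* Let $q>0$, $\alpha\in[0,1]$ and let $n\ge 1$ be an integer. The operator $T_{n,q,\alpha}$ has $n+1$ linearly independent monic eigenvectors $p_{k,q}^{(\alpha,n)}(x)$, where $p_{k,q}^{(\alpha,n)}$ is a polynomial of degree $k$, $k=0,1,\ldots,n$, corresponding respectively to the eigenvalues $\lambda_{0,q}^{(\alpha,n)}=\lambda_{1,q}^{(\alpha,n)}=1$ and $$\lambda_{k,q}^{(\alpha,n)}=\frac{q^{k(k-1)/2}\,[n-2]_q!}{[n-k]_q!\,[n]_q^k}\Big((1-\alpha)[n-k]_q[n-1+k]_q+\alpha[n]_q[n-1]_q\Big),\qquad k=2,3,\ldots,n.$$
   Context: For $q>0$: $[0]_q=0$, $[m]_q=1+q+\cdots+q^{m-1}$ for $m\ge1$; $[0]_q!=1$, $[m]_q!=[1]_q[2]_q\cdots[m]_q$. The $q$-binomial coefficient is $\left[{m\atop k}\right]_q=\frac{[m]_q!}{[k]_q!\,[m-k]_q!}$ for $0\le k\le m$, and it is $0$ for $k<0$ or $k>m$. Also $(x;q)_0=1$, $(x;q)_k=\prod_{s=0}^{k-1}(1-xq^s)$. The $(\alpha,q)$-Bernstein operator $T_{n,q,\alpha}$ maps a function $f$ on $[0,1]$ to the polynomial $$T_{n,q,\alpha}(f;x)=\sum_{i=0}^n f\!\left(\frac{[i]_q}{[n]_q}\right)p_{n,q,i}^{(\alpha)}(x),$$ where $p_{1,q,0}^{(\alpha)}(x)=1-x$, $p_{1,q,1}^{(\alpha)}(x)=x$, and for $n\ge2$, $0\le i\le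 n$, $$p_{n,q,i}^{(\alpha)}(x)=\left(\left[{n-2\atop i}\right]_q\frac{(1-\alpha)x}{1-q^{n-i-1}x}+\left[{n-2\atop i-2}\right]_q(1-\alpha)q^{n-i}+\left[{n\atop i}\right]_q\alpha x\right)x^{i-1}(x;q)_{n-i},$$ understood as a polynomial in $x$ after cancellation (terms with a zero $q$-binomial coefficient are omitted). An eigenvector of $T_{n,q,\alpha}$ for the eigenvalue $\lambda$ is a nonzero $p$ with $T_{n,q,\alpha}(p;x)=\lambda p(x)$. *)

theory Defs
  imports "HOL-Analysis.Analysis" "HOL-Computational_Algebra.Polynomial"
begin

definition q_int :: "real \<Rightarrow> nat \<Rightarrow> real" where
  "q_int q m = (\<Sum>j<m. q ^ j)"

definition q_fact :: "real \<Rightarrow> nat \<Rightarrow> real" where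
  "q_fact q m = (\<Prod>j=1..m. q_int q j)"

text \<open>The lower index is an integer, so that the convention for negative lower indices is not
  lost to truncated subtraction.\<close>

definition q_binom :: "real \<Rightarrow> nat \<Rightarrow> int \<Rightarrow> real" where
  "q_binom q m k =
     (if 0 \<le> k \<and> k \<le> int m then q_fact q m / (q_fact q (nat k) * q_fact q (m - nat k)) else 0)"

text \<open>Polymorphic, since the first argument is used both as a number and as the indeterminate.\<close>

definition q_poch :: "'a::comm_ring_1 \<Rightarrow> 'a \<Rightarrow> nat \<Rightarrow> 'a" where
  "q_poch x q k = (\<Prod>s<k. 1 - x * q ^ s)"

text \<open>
  The basis polynomials \<open>p\<^bsub>n,q,i\<^esub>\<^sup>(\<^sup>\<alpha>\<^sup>)\<close>, written after cancellation. In the first term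
  \<open>x / (1 - q\<^bsup>n-i-1\<^esup> x) \<cdot> x\<^bsup>i-1\<^esup> (x;q)\<^bsub>n-i\<^esub> = x\<^bsup>i\<^esup> (x;q)\<^bsub>n-i-1\<^esub>\<close>; the natural number \<open>n - i - 1\<close> is
  truncated only for \<open>i = n\<close>, and \<open>i - 1\<close> in the second term only for \<open>i = 0\<close>, where the
  respective \<open>q\<close>-binomial coefficient is zero. The lemma \<open>poly_bernstein_basis\<close> below recovers
  the rational expression.
\<close>

definition bernstein_basis :: "nat \<Rightarrow> real \<Rightarrow> real \<Rightarrow> nat \<Rightarrow> real poly" where
  "bernstein_basis n q \<alpha> i =
     (let X = [:0, 1:]; Q = [:q:] in
      if n = 1 then (if i = 0 then 1 - X else X)
      else
        smult (q_binom q (n - 2) (int i) * (1 - \<alpha>)) (X ^ i * q_poch X Q (n - i - 1))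
      + smult (q_binom q (n - 2) (int i - 2) * (1 - \<alpha>) * q ^ (n - i))
          (X ^ (i - 1) * q_poch X Q (n - i))
      + smult (q_binom q n (int i) * \<alpha>) (X ^ i * q_poch X Q (n - i)))"

lemma poly_q_poch: "poly (q_poch [:0, 1:] [:q:] k) x = q_poch x (q::real) k"
  by (simp add: q_poch_def poly_prod poly_power)

lemma poly_bernstein_basis:
  assumes n: "n \<ge> 2" and i: "i \<le> n" and x: "x \<noteq> 0"
    and pole: "i < n \<Longrightarrow> 1 - q ^ (n - i - 1) * x \<noteq> 0"
  shows "poly (bernstein_basis n q \<alpha> i) x =
     (q_binom q (n - 2) (int i) * ((1 - \<alpha>) * x / (1 - q powi (int n - int i - 1) * x))
      + q_binom q (n - 2) (int i - 2) * (1 - \<alpha>) * q ^ (n - i)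
      + q_binom q n (int i) * \<alpha> * x) * x powi (int i - 1) * q_poch x q (n - i)"
proof -
  have xp: "x * x powi (int i - 1) = x ^ i"
    using x power_int_add_1'[of x "int i - 1"] by simp
  have t1: "q_binom q (n - 2) (int i) * (x ^ i * q_poch x q (n - i - 1)) =
    q_binom q (n - 2) (int i) * (x / (1 - q powi (int n - int i - 1) * x)
      * x powi (int i - 1) * q_poch x q (n - i))"
  proof (cases "i < n")
    case True
    then have e: "int n - int i - 1 = int (n - i - 1)" and s: "n - i = Suc (n - i - 1)"
      by auto
    have p: "q_poch x q (n - i) = q_poch x q (n - i - 1) * (1 - q ^ (n - i - 1) * x)"
      by (subst s) (simp add: q_poch_def mult.commute)
    show ?thesis
      unfolding e power_int_of_nat p xp[symmetric] using pole[OF True] by simp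
  next
    case False
    then show ?thesis using n by (simp add: q_binom_def)
  qed
  have t2: "q_binom q (n - 2) (int i - 2) * x ^ (i - 1) =
    q_binom q (n - 2) (int i - 2) * x powi (int i - 1)"
  proof (cases "i = 0")
    case False
    then have "int i - 1 = int (i - 1)" by simp
    then show ?thesis by (simp only: power_int_of_nat)
  qed (simp add: q_binom_def)
  have "poly (bernstein_basis n q \<alpha> i) x =
      (1 - \<alpha>) * (q_binom q (n - 2) (int i) * (x ^ i * q_poch x q (n - i - 1)))
    + (1 - \<alpha>) * q ^ (n - i) * q_poch x q (n - i) * (q_binom q (n - 2) (int i - 2) * x ^ (i - 1))
    + q_binom q n (int i) * \<alpha> * q_poch x q (n - i) * x ^ i"
    using n by (simp add: bernstein_basis_def Let_def poly_q_poch poly_power algebra_simps)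
  then have lhs: "poly (bernstein_basis n q \<alpha> i) x =
      (1 - \<alpha>) * (q_binom q (n - 2) (int i) * (x / (1 - q powi (int n - int i - 1) * x)
        * x powi (int i - 1) * q_poch x q (n - i)))
    + (1 - \<alpha>) * q ^ (n - i) * q_poch x q (n - i)
        * (q_binom q (n - 2) (int i - 2) * x powi (int i - 1))
    + q_binom q n (int i) * \<alpha> * q_poch x q (n - i) * (x * x powi (int i - 1))"
    unfolding t1 t2 xp .
  have frac: "(1 - \<alpha>) * x / d = (1 - \<alpha>) * (x / d)" for d
    by simp
  show ?thesis
    unfolding lhs frac by (simp only: distrib_right distrib_left mult.commute mult.left_commute mult.assoc)
qed

text \<open>Only the values of \<open>f\<close> on \<open>[0, 1]\<close> enter, since \<open>0 \<le> [i]\<^sub>q / [n]\<^sub>q \<le> 1\<close>.\<close>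

definition bernstein_op :: "nat \<Rightarrow> real \<Rightarrow> real \<Rightarrow> (real \<Rightarrow> real) \<Rightarrow> real poly" where
  "bernstein_op n q \<alpha> f =
     (\<Sum>i\<le>n. smult (f (q_int q i / q_int q n)) (bernstein_basis n q \<alpha> i))"

text \<open>
  A polynomial as eigenvector. The equation is between polynomials; on \<open>[0, 1]\<close>, or on any
  infinite set, equality of values says the same.
\<close>

definition bernstein_eigenvector :: "nat \<Rightarrow> real \<Rightarrow> real \<Rightarrow> real \<Rightarrow> real poly \<Rightarrow> bool" where
  "bernstein_eigenvector n q \<alpha> \<mu> p \<longleftrightarrow>
     p \<noteq> 0 \<and> bernstein_op n q \<alpha> (poly p) = smult \<mu> p"

definition bernstein_eigenvalue :: "nat \<Rightarrow> real \<Rightarrow> real \<Rightarrow> nat \<Rightarrow> real" where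
  "bernstein_eigenvalue n q \<alpha> k =
     (if k \<le> 1 then 1
      else q ^ (k * (k - 1) div 2) * q_fact q (n - 2) / (q_fact q (n - k) * q_int q n ^ k)
         * ((1 - \<alpha>) * q_int q (n - k) * q_int q (n - 1 + k) + \<alpha> * q_int q n * q_int q (n - 1)))"

interpretation poly_vs: vector_space "smult :: real \<Rightarrow> real poly \<Rightarrow> real poly"
  by unfold_locales (simp_all add: smult_add_left smult_add_right)

end

theory Submission
  imports Defs
begin

text \<open>
  The operator is triangular on monomials: the image of \<open>x\<^sup>k\<close> has degree at most \<open>k\<close>, and the
  coefficient of \<open>x\<^sup>k\<close> in it is \<open>\<lambda>\<^sub>k\<close>. The numbers \<open>1 = \<lambda>\<^sub>1 > \<lambda>\<^sub>2 > \<dots> > \<lambda>\<^sub>n\<close> are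
  distinct, so for \<open>k \<ge> 2\<close> the lower coefficients of a monic eigenvector can be found one after the
  other. The coincidence \<open>\<lambda>\<^sub>0 = \<lambda>\<^sub>1 = 1\<close> does no harm, because the operator fixes both \<open>1\<close> and
  \<open>x\<close>. Polynomials of distinct degrees are independent.

  Triangularity comes from the \<open>q\<close>-Bernstein form
  \<open>B\<^sub>m(c) = \<Sum>\<^sub>j [m, j]\<^sub>q c\<^sub>j x\<^sup>j (x;q)\<^bsub>m-j\<^esub>\<close> of a finite sequence. The absorption rule
  \<open>[j] [m, j] = [m] [m-1, j-1]\<close> gives \<open>B\<^sub>m([j] c\<^sub>j) = [m] x B\<^bsub>m-1\<^esub>(c\<^bsub>j+1\<^esub>)\<close>
  (\<open>q_bernstein_mult_q_int\<close>), and \<open>[j+1] = 1 + q [j]\<close> turns a polynomial in \<open>[j+1]\<close> into one in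
  \<open>[j]\<close>. By induction on \<open>k\<close>, a sequence that is a polynomial of degree \<open>k\<close> in \<open>[j]\<close> has a form
  of degree at most \<open>k\<close> with an explicit top coefficient (\<open>q_bernstein_poly\<close>).

  With \<open>f\<^sub>j = f([j]/[n])\<close>, regrouping the basis polynomials (\<open>bernstein_op_decomp\<close>) gives
  \<open>T f = (1-\<alpha>) (B\<^bsub>n-2\<^esub>(f\<^sub>j) + x B\<^bsub>n-2\<^esub>(q\<^bsup>n-2-j\<^esup> (f\<^bsub>j+2\<^esub> - f\<^sub>j))) + \<alpha> B\<^sub>n(f\<^sub>j)\<close>.
  If \<open>f = x\<^sup>k\<close>, the difference \<open>f\<^bsub>j+2\<^esub> - f\<^sub>j\<close> is \<open>q\<^sup>j\<close> times a polynomial of degree \<open>k - 1\<close> in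
  \<open>[j]\<close>, so the powers of \<open>q\<close> cancel to the constant \<open>q\<^bsup>n-2\<^esup>\<close> and every form in this formula has
  a polynomial argument. Adding up the top coefficients yields \<open>\<lambda>\<^sub>k\<close>.
\<close>

section \<open>Arithmetic of \<open>q\<close>-integers and \<open>q\<close>-binomial coefficients\<close>

lemma q_int_0 [simp]: "q_int q 0 = 0"
  by (simp add: q_int_def)

lemma q_int_1 [simp]: "q_int q (Suc 0) = 1"
  by (simp add: q_int_def)

lemma q_int_add: "q_int q (a + b) = q_int q a + q ^ a * q_int q b"
  by (induction b) (simp_all add: q_int_def power_add algebra_simps)

lemma q_int_Suc_left: "q_int q (Suc a) = 1 + q * q_int q a"
  using q_int_add[of q 1 a] by simp

lemma q_int_pos: "q > 0 \<Longrightarrow> m > 0 \<Longrightarrow> q_int q m > 0"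
  by (auto simp: q_int_def intro!: sum_pos)

lemma q_int_nonneg: "q > 0 \<Longrightarrow> q_int q m \<ge> 0"
  by (auto simp: q_int_def intro!: sum_nonneg)

lemma q_fact_0 [simp]: "q_fact q 0 = 1"
  by (simp add: q_fact_def)

lemma q_fact_Suc: "q_fact q (Suc m) = q_int q (Suc m) * q_fact q m"
  by (simp add: q_fact_def)

lemma q_fact_pos: "q > 0 \<Longrightarrow> q_fact q m > 0"
  by (auto simp: q_fact_def intro!: prod_pos q_int_pos)

lemma q_binom_nat:
  "j \<le> m \<Longrightarrow> q_binom q m (int j) = q_fact q m / (q_fact q j * q_fact q (m - j))"
  by (simp add: q_binom_def)

lemma q_binom_eq_0: "m < j \<Longrightarrow> q_binom q m (int j) = 0"
  by (simp add: q_binom_def)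

lemma q_binom_0 [simp]: "q > 0 \<Longrightarrow> q_binom q m 0 = 1"
  using q_fact_pos[of q m] by (simp add: q_binom_def)

lemma q_binom_absorb:
  assumes "q > 0" "j \<le> m"
  shows "q_binom q (Suc m) (int (Suc j)) * q_int q (Suc j) = q_int q (Suc m) * q_binom q m (int j)"
  using assms q_int_pos[of q "Suc j"] q_fact_pos[of q j] q_fact_pos[of q "m - j"]
  by (simp add: q_binom_nat q_fact_Suc field_simps del: of_nat_Suc)

text \<open>
  Of the two Pascal rules this is the one with the power of \<open>q\<close> on the term of lower index; it is
  the one that matches \<open>(x;q)\<^bsub>m+1-j\<^esub> = (x;q)\<^bsub>m-j\<^esub> (1 - q\<^bsup>m-j\<^esup> x)\<close> in the partition of unity.
\<close>

lemma q_binom_pascal: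
  assumes "q > 0" "j \<le> m"
  shows "q_binom q (Suc m) (int (Suc j)) =
    q_binom q m (int (Suc j)) + q ^ (m - j) * q_binom q m (int j)"
proof (cases "j = m")
  case True
  then show ?thesis
    using assms q_fact_pos[of q m] q_fact_pos[of q "Suc m"]
    by (simp add: q_binom_nat q_binom_eq_0 del: of_nat_Suc)
next
  case False
  \<comment> \<open>The rule reduces to \<open>[m+1] = [d+1] + q\<^bsup>d+1\<^esup> [j+1]\<close>.\<close>
  define d where "d = m - Suc j"
  have m: "m = Suc (j + d)"
    using False assms by (simp add: d_def)
  have "q_int q (Suc m) = q_int q (Suc d) + q ^ Suc d * q_int q (Suc j)"
    using q_int_add[of q "Suc d" "Suc j"] by (simp add: m algebra_simps)
  moreover have "q_int q (Suc j) > 0" "q_int q (Suc d) > 0" "q_fact q j > 0" "q_fact q d > 0"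
    using assms by (simp_all add: q_int_pos q_fact_pos)
  moreover have "Suc m - Suc j = Suc d" "m - Suc j = d" "m - j = Suc d" "Suc j \<le> m"
    using m by auto
  moreover have "q_binom q (Suc m) (int (Suc j)) =
      q_int q (Suc m) * q_fact q m / (q_fact q (Suc j) * q_fact q (Suc d))"
    using calculation by (subst q_binom_nat) (simp_all add: q_fact_Suc)
  ultimately show ?thesis
    using assms by (simp add: q_binom_nat q_fact_Suc field_simps del: of_nat_Suc power_Suc)
qed

section \<open>The \<open>q\<close>-Bernstein form of a sequence\<close>

definition q_bernstein :: "real \<Rightarrow> nat \<Rightarrow> (nat \<Rightarrow> real) \<Rightarrow> real poly" where
  "q_bernstein q m c =
     (\<Sum>j\<le>m. smult (q_binom q m (int j) * c j) ([:0, 1:] ^ j * q_poch [:0, 1:] [:q:] (m - j)))"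

lemma smult_sum_right: "smult a (\<Sum>i\<in>A. f i) = (\<Sum>i\<in>A. smult a (f i))"
  by (induction A rule: infinite_finite_induct) (simp_all add: smult_add_right)

lemma q_bernstein_add: "q_bernstein q m (\<lambda>j. c j + d j) = q_bernstein q m c + q_bernstein q m d"
  by (simp add: q_bernstein_def distrib_left smult_add_left sum.distrib)

lemma q_bernstein_cmult: "q_bernstein q m (\<lambda>j. a * c j) = smult a (q_bernstein q m c)"
  by (simp add: q_bernstein_def smult_sum_right mult.left_commute)

lemma q_bernstein_cong:
  "(\<And>j. j \<le> m \<Longrightarrow> c j = d j) \<Longrightarrow> q_bernstein q m c = q_bernstein q m d"
  by (simp add: q_bernstein_def)

text \<open>
  Pascal's rule splits each term of \<open>B\<^bsub>m+1\<^esub>(1)\<close> in two. The part without a power of \<open>q\<close>, after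
  splitting off the last factor \<open>1 - q\<^bsup>m-j\<^esup> x\<close>, is \<open>B\<^sub>m(1)\<close> minus exactly the other part.
\<close>

lemma q_bernstein_one:
  assumes "q > 0"
  shows "q_bernstein q m (\<lambda>_. 1) = 1"
proof (induction m)
  case 0
  then show ?case using assms by (simp add: q_bernstein_def q_poch_def)
next
  case (Suc m)
  define X Q where "X = [:0, 1::real:]" and "Q = [:q:]"
  define b where "b j = q_binom q m (int j)" for j
  define t where "t j = X ^ j * q_poch X Q (m - j)" for j
  have split: "smult (q_binom q (Suc m) (int (Suc j))) (X ^ Suc j * q_poch X Q (m - j)) =
     smult (b (Suc j)) (X ^ Suc j * q_poch X Q (m - j)) + smult (b j) (Q ^ (m - j) * X * t j)"
    if "j \<le> m" for j
  proof -
    have "smult (q ^ (m - j)) p = Q ^ (m - j) * p" for p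
      by (simp add: Q_def poly_const_pow)
    then show ?thesis
      unfolding q_binom_pascal[OF assms that] b_def t_def smult_add_left
      by (simp add: smult_smult[symmetric] mult_ac)
  qed
  have "q_bernstein q (Suc m) (\<lambda>_. 1) =
     q_poch X Q (Suc m) + (\<Sum>j\<le>m. smult (q_binom q (Suc m) (int (Suc j))) (X ^ Suc j * q_poch X Q (m - j)))"
    unfolding q_bernstein_def sum.atMost_Suc_shift X_def Q_def using assms
    by (simp del: of_nat_Suc)
  also have "\<dots> = (q_poch X Q (Suc m) + (\<Sum>j\<le>m. smult (b (Suc j)) (X ^ Suc j * q_poch X Q (m - j))))
      + (\<Sum>j\<le>m. smult (b j) (Q ^ (m - j) * X * t j))"
    unfolding add.assoc sum.distrib[symmetric]
    by (intro arg_cong[where f = "(+) (q_poch X Q (Suc m))"] sum.cong refl split) simp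
  also have "q_poch X Q (Suc m) + (\<Sum>j\<le>m. smult (b (Suc j)) (X ^ Suc j * q_poch X Q (m - j))) =
      (\<Sum>j\<le>Suc m. smult (b j) (X ^ j * q_poch X Q (Suc m - j)))"
    unfolding sum.atMost_Suc_shift using assms by (simp add: b_def del: of_nat_Suc)
  also have "\<dots> = (\<Sum>j\<le>m. smult (b j) (X ^ j * q_poch X Q (Suc m - j)))"
    by (simp add: b_def q_binom_eq_0 del: of_nat_Suc)
  also have "\<dots> = (\<Sum>j\<le>m. smult (b j) (t j - Q ^ (m - j) * X * t j))"
    by (intro sum.cong refl) (simp add: t_def Suc_diff_le q_poch_def algebra_simps)
  finally show ?case
    using Suc.IH by (simp add: smult_diff_right sum_subtractf q_bernstein_def b_def t_def X_def Q_def)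
qed

lemma q_bernstein_const: "q > 0 \<Longrightarrow> q_bernstein q m (\<lambda>_. a) = [:a:]"
  using q_bernstein_cmult[of q m a "\<lambda>_. 1"] q_bernstein_one[of q m] by (simp add: one_pCons)

text \<open>
  The recursion behind all degree computations: a factor \<open>[j]\<close> in the sequence is traded, by
  absorption into the \<open>q\<close>-binomial coefficient, for a factor \<open>[m] x\<close> in front. For \<open>m = 0\<close> the
  truncated \<open>m - 1\<close> is harmless because \<open>[0] = 0\<close>.
\<close>

lemma q_bernstein_mult_q_int:
  assumes "q > 0"
  shows "q_bernstein q m (\<lambda>j. q_int q j * c j) =
    smult (q_int q m) (pCons 0 (q_bernstein q (m - 1) (\<lambda>j. c (Suc j))))"
proof (cases m)
  case 0
  then show ?thesis by (simp add: q_bernstein_def)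
next
  case (Suc l)
  let ?t = "\<lambda>j. [:0, 1:] ^ j * q_poch [:0, 1:] [:q:] (l - j)"
  have "q_bernstein q (Suc l) (\<lambda>j. q_int q j * c j) =
     (\<Sum>j\<le>l. smult (q_binom q (Suc l) (int (Suc j)) * q_int q (Suc j) * c (Suc j)) ([:0, 1:] * ?t j))"
    unfolding q_bernstein_def sum.atMost_Suc_shift by (simp add: mult_ac del: of_nat_Suc)
  also have "\<dots> = (\<Sum>j\<le>l. smult (q_int q (Suc l)) ([:0, 1:] * smult (q_binom q l (int j) * c (Suc j)) (?t j)))"
    by (intro sum.cong refl) (simp add: q_binom_absorb[OF assms] mult.assoc del: of_nat_Suc)
  also have "\<dots> = smult (q_int q (Suc l)) ([:0, 1:] * q_bernstein q l (\<lambda>j. c (Suc j)))"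
    by (simp only: q_bernstein_def sum_distrib_left smult_sum_right)
  finally show ?thesis using Suc by simp
qed

lemma coeff_pcompose_linear:
  fixes P :: "real poly"
  assumes "b \<noteq> 0" "degree P \<le> k"
  shows "coeff (pcompose P [:a, b:]) k = coeff P k * b ^ k"
proof -
  have d: "degree (pcompose P [:a, b:]) = degree P"
    using assms by (simp add: degree_pcompose)
  show ?thesis
  proof (cases "degree P = k")
    case True
    then show ?thesis
      using lead_coeff_comp[of "[:a, b:]" P] assms d by simp
  next
    case False
    then show ?thesis
      using assms d by (simp add: coeff_eq_0)
  qed
qed

lemma triangular_exponent_Suc: "Suc k * (Suc k - 1) div 2 = k + k * (k - 1) div 2"
proof -
  have "Suc k * (Suc k - 1) = 2 * k + k * (k - 1)"
    by (cases k) auto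
  then show ?thesis by simp
qed

text \<open>
  Write \<open>P = a + t R\<close>. The constant contributes \<open>a\<close>, and \<open>t R\<close> contributes \<open>[m] x\<close> times the form
  of \<open>R([j+1]) = R(1 + q [j])\<close>, a polynomial of lower degree whose top coefficient has gained
  \<open>q\<^sup>k\<close>. These powers accumulate to \<open>q\<^bsup>k(k-1)/2\<^esup>\<close>. For \<open>k > m\<close> the product contains
  \<open>[0] = 0\<close>, in agreement with the fact that the form has degree at most \<open>m\<close>.
\<close>

lemma q_bernstein_poly:
  assumes "q > 0" "degree P \<le> k"
  shows "degree (q_bernstein q m (\<lambda>j. poly P (q_int q j))) \<le> k \<and>
    coeff (q_bernstein q m (\<lambda>j. poly P (q_int q j))) k =
      coeff P k * q ^ (k * (k - 1) div 2) * (\<Prod>i<k. q_int q (m - i))"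
  using assms(2)
proof (induction k arbitrary: P m)
  case 0
  then obtain a where "P = [:a:]"
    using degree0_coeffs by auto
  then show ?case
    using assms(1) by (simp add: q_bernstein_const)
next
  case (Suc k)
  obtain a R where P: "P = pCons a R"
    by (cases P)
  have R: "degree R \<le> k"
    using Suc.prems P by (cases "R = 0") auto
  define S where "S = pcompose R [:1, q:]"
  have S: "degree S \<le> k"
    using R assms(1) by (simp add: S_def degree_pcompose)
  let ?B = "q_bernstein q (m - 1) (\<lambda>j. poly S (q_int q j))"
  have "q_bernstein q m (\<lambda>j. poly P (q_int q j)) =
      [:a:] + q_bernstein q m (\<lambda>j. q_int q j * poly R (q_int q j))"
    using assms(1) by (simp add: P q_bernstein_add q_bernstein_const)
  also have "\<dots> = [:a:] + smult (q_int q m) (pCons 0 ?B)"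
    by (simp add: q_bernstein_mult_q_int assms(1) S_def poly_pcompose q_int_Suc_left mult.commute)
  finally have eq: "q_bernstein q m (\<lambda>j. poly P (q_int q j)) = pCons a (smult (q_int q m) ?B)"
    by simp
  have IH: "degree ?B \<le> k"
    "coeff ?B k = coeff S k * q ^ (k * (k - 1) div 2) * (\<Prod>i<k. q_int q (m - 1 - i))"
    using Suc.IH[OF S, of "m - 1"] by auto
  have "degree (smult (q_int q m) ?B) \<le> k"
    using IH(1) degree_smult_le order_trans by blast
  then have "degree (pCons a (smult (q_int q m) ?B)) \<le> Suc k"
    by (meson Suc_le_mono degree_pCons_le order_trans)
  moreover have "coeff S k = coeff R k * q ^ k"
    unfolding S_def using assms(1) R by (intro coeff_pcompose_linear) auto
  moreover have "(\<Prod>i<Suc k. q_int q (m - i)) = q_int q m * (\<Prod>i<k. q_int q (m - 1 - i))"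
    unfolding prod.lessThan_Suc_shift by simp
  ultimately show ?case
    unfolding eq unfolding triangular_exponent_Suc P coeff_pCons_Suc coeff_smult IH(2)
    by (simp only: power_add mult_ac simp_thms)
qed

section \<open>The \<open>(\<alpha>, q)\<close>-Bernstein operator is triangular\<close>

text \<open>
  Both parts of the basis with the factor \<open>1 - \<alpha>\<close> are brought to the terms
  \<open>x\<^sup>j (x;q)\<^bsub>n-2-j\<^esub>\<close>: in the first the last factor \<open>1 - q\<^bsup>n-2-j\<^esup> x\<close> of the \<open>q\<close>-Pochhammer symbol
  is expanded, in the second the index is shifted by \<open>i = j + 2\<close>. The terms with a factor
  \<open>q\<^bsup>n-2-j\<^esup> x\<close> then combine to the form of the differences.
\<close>

lemma bernstein_op_decomp:
  fixes q \<alpha> :: real and f :: "real \<Rightarrow> real"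
  assumes "n \<ge> 2"
  defines "F \<equiv> \<lambda>j. f (q_int q j / q_int q n)"
  shows "bernstein_op n q \<alpha> f =
    smult (1 - \<alpha>) (q_bernstein q (n - 2) F
      + pCons 0 (q_bernstein q (n - 2) (\<lambda>j. q ^ (n - 2 - j) * (F (j + 2) - F j))))
    + smult \<alpha> (q_bernstein q n F)"
proof -
  obtain m where n: "n = m + 2"
    using assms(1) by (metis add.commute le_Suc_ex)
  define X Q where "X = [:0, 1::real:]" and "Q = [:q:]"
  define b where "b j = q_binom q m (int j)" for j
  define t where "t j = X ^ j * q_poch X Q (m - j)" for j
  define G where "G = F"
  define A where "A i = smult (q_binom q m (int i) * (1 - \<alpha>) * G i) (X ^ i * q_poch X Q (n - i - 1))" for i
  define C where "C i = smult (q_binom q m (int i - 2) * (1 - \<alpha>) * q ^ (n - i) * G i)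
      (X ^ (i - 1) * q_poch X Q (n - i))" for i
  have comb: "smult a (r - X * smult u p) + smult a (X * smult w p) = smult a (r + X * smult (w - u) p)"
    for a u w r p
    by (simp add: algebra_simps smult_diff_left smult_diff_right smult_add_right)
  have "bernstein_op n q \<alpha> f = (\<Sum>i\<le>n. A i + C i +
      smult \<alpha> (smult (q_binom q n (int i) * G i) (X ^ i * q_poch X Q (n - i))))"
    unfolding bernstein_op_def
    by (intro sum.cong refl)
      (simp add: bernstein_basis_def Let_def n A_def C_def G_def F_def X_def Q_def
        smult_add_right mult_ac)
  also have "\<dots> = sum A {..n} + sum C {..n} + smult \<alpha> (q_bernstein q n G)"
    by (simp only: sum.distrib q_bernstein_def X_def Q_def smult_sum_right)
  also have "sum A {..n} = sum A {..m}"
    using q_binom_eq_0[of m "Suc m" q] q_binom_eq_0[of m "Suc (Suc m)" q] by (simp add: n A_def)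
  also have "\<dots> = (\<Sum>j\<le>m. smult (1 - \<alpha>) (smult (b j * G j) (t j)
      - X * smult (b j * (q ^ (m - j) * G j)) (t j)))"
  proof (intro sum.cong refl)
    fix j assume "j \<in> {..m}"
    then have e: "n - j - 1 = Suc (m - j)" using n by auto
    have "q_poch X Q (Suc (m - j)) = q_poch X Q (m - j) - X * smult (q ^ (m - j)) (q_poch X Q (m - j))"
      by (simp add: q_poch_def Q_def poly_const_pow algebra_simps)
    then show "A j = smult (1 - \<alpha>) (smult (b j * G j) (t j)
      - X * smult (b j * (q ^ (m - j) * G j)) (t j))"
      unfolding A_def e by (simp add: b_def t_def smult_diff_right right_diff_distrib mult_ac)
  qed
  also have "sum C {..n} = (\<Sum>j\<le>m. C (j + 2))"
  proof -
    have "C 0 = 0" "C 1 = 0"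
      by (simp_all add: C_def q_binom_def)
    then show ?thesis
      by (simp add: n sum.atMost_Suc_shift del: sum.atMost_Suc)
  qed
  also have "\<dots> = (\<Sum>j\<le>m. smult (1 - \<alpha>) (X * smult (b j * (q ^ (m - j) * G (j + 2))) (t j)))"
    by (intro sum.cong refl) (simp add: C_def b_def t_def n mult_ac)
  finally have "bernstein_op n q \<alpha> f =
      (\<Sum>j\<le>m. smult (1 - \<alpha>) (smult (b j * G j) (t j)
        + X * smult (b j * (q ^ (m - j) * (G (j + 2) - G j))) (t j)))
      + smult \<alpha> (q_bernstein q n G)"
    by (simp only: sum.distrib[symmetric] comb right_diff_distrib[symmetric])
  also have "(\<Sum>j\<le>m. smult (1 - \<alpha>) (smult (b j * G j) (t j)
        + X * smult (b j * (q ^ (m - j) * (G (j + 2) - G j))) (t j))) =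
      smult (1 - \<alpha>) (q_bernstein q m G + X * q_bernstein q m (\<lambda>j. q ^ (m - j) * (G (j + 2) - G j)))"
    by (simp only: sum.distrib q_bernstein_def X_def Q_def smult_sum_right sum_distrib_left
        smult_add_right b_def t_def)
  finally show ?thesis
    by (simp add: n G_def X_def)
qed

lemma bernstein_op_one:
  assumes "q > 0" "n \<ge> 1"
  shows "bernstein_op n q \<alpha> (\<lambda>_. 1) = 1"
proof (cases "n = 1")
  case True
  then show ?thesis
    by (simp add: bernstein_op_def bernstein_basis_def Let_def)
next
  case False
  then have "n \<ge> 2" using assms by simp
  then show ?thesis
    using assms q_bernstein_const[of q "n - 2" 0]
    by (simp add: bernstein_op_decomp q_bernstein_one smult_add_left[symmetric])
qed

lemma bernstein_op_id:
  assumes "q > 0" "n \<ge> 1"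
  shows "bernstein_op n q \<alpha> (\<lambda>x. x) = [:0, 1:]"
proof (cases "n = 1")
  case True
  then show ?thesis
    by (simp add: bernstein_op_def bernstein_basis_def Let_def)
next
  case False
  then have n: "n \<ge> 2" using assms by simp
  have pos: "q_int q n > 0" using assms q_int_pos by simp
  have lin: "q_bernstein q m (\<lambda>j. q_int q j / q_int q n) = [:0, q_int q m / q_int q n:]" for m
    using q_bernstein_mult_q_int[OF assms(1), of m "\<lambda>_. 1 / q_int q n"] assms(1)
    by (simp add: q_bernstein_const)
  have "q ^ (n - 2 - j) * (q_int q (j + 2) / q_int q n - q_int q j / q_int q n) =
      q ^ (n - 2) * q_int q 2 / q_int q n" if "j \<le> n - 2" for j
  proof -
    have "q_int q (j + 2) = q_int q j + q ^ j * q_int q 2"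
      by (rule q_int_add)
    then have "q_int q (j + 2) / q_int q n - q_int q j / q_int q n = q ^ j * q_int q 2 / q_int q n"
      by (simp add: diff_divide_distrib[symmetric])
    moreover have "q ^ (n - 2) = q ^ (n - 2 - j) * q ^ j"
      using that by (metis le_add_diff_inverse2 power_add)
    ultimately show ?thesis by (simp only: times_divide_eq_right mult.assoc)
  qed
  then have "q_bernstein q (n - 2) (\<lambda>j. q ^ (n - 2 - j) *
      (q_int q (j + 2) / q_int q n - q_int q j / q_int q n)) = [:q ^ (n - 2) * q_int q 2 / q_int q n:]"
    using q_bernstein_const[OF assms(1), of "n - 2"]
      q_bernstein_cong[of "n - 2" _ "\<lambda>_. q ^ (n - 2) * q_int q 2 / q_int q n"]
    by simp
  moreover have "q_int q (n - 2) / q_int q n + q ^ (n - 2) * q_int q 2 / q_int q n = 1"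
  proof -
    have "q_int q n = q_int q (n - 2) + q ^ (n - 2) * q_int q 2"
      using q_int_add[of q "n - 2" 2] n by (metis le_add_diff_inverse2)
    then show ?thesis using pos by (simp add: add_divide_distrib[symmetric])
  qed
  ultimately show ?thesis
    unfolding bernstein_op_decomp[OF n] lin using pos by (simp add: add.commute)
qed

lemma q_int_double: "q_int q (2 * k) = q_int q 2 * (\<Sum>s<k. q ^ (2 * s))"
proof (induction k)
  case (Suc k)
  have "q_int q (2 * Suc k) = q_int q (2 * k) + q ^ (2 * k) * q_int q 2"
    using q_int_add[of q "2 * k" 2] by simp
  then show ?case using Suc by (simp add: algebra_simps)
qed simp

text \<open>
  The restriction \<open>k \<le> m\<close> matters: beyond it the product is \<open>0\<close>, while the truncated
  quotient is not.
\<close>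

lemma prod_q_int_falling:
  assumes "k \<le> m" "q > 0"
  shows "(\<Prod>i<k. q_int q (m - i)) = q_fact q m / q_fact q (m - k)"
  using assms(1)
proof (induction k)
  case 0
  then show ?case using q_fact_pos[OF assms(2), of m] by simp
next
  case (Suc k)
  then have e: "m - k = Suc (m - Suc k)" by simp
  have "q_fact q (m - k) = q_int q (m - k) * q_fact q (m - Suc k)"
    unfolding e by (rule q_fact_Suc)
  moreover have "q_int q (m - k) > 0" using Suc assms(2) by (intro q_int_pos) auto
  ultimately show ?case using Suc by simp
qed

text \<open>
  Since \<open>[j+2] - [j] = q\<^sup>j [2]\<close>, the quotient of the difference by \<open>q\<^sup>j [2]\<close> is
  \<open>R = \<Sum>\<^sub>s [j+2]\<^sup>s [j]\<^bsup>k-1-s\<^esup>\<close>, and \<open>[j+2] = [2] + q\<^sup>2 [j]\<close> makes it a polynomial in \<open>[j]\<close>.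
  Its top coefficient \<open>\<Sum>\<^sub>s q\<^bsup>2s\<^esup>\<close> is \<open>[2k] / [2]\<close>.
\<close>

lemma q_int_add2_power_diff:
  assumes "k \<ge> 1"
  obtains R :: "real poly" where "degree R \<le> k - 1" "q_int q 2 * coeff R (k - 1) = q_int q (2 * k)"
    "\<And>j. q_int q (j + 2) ^ k - q_int q j ^ k = q ^ j * q_int q 2 * poly R (q_int q j)"
proof
  define Y where "Y = [:q_int q 2, q ^ 2:]"
  define R where "R = (\<Sum>s<k. monom 1 (k - Suc s) * Y ^ s)"
  have degY: "degree (Y ^ s) \<le> s" for s
  proof -
    have "degree (Y ^ s) \<le> degree Y * s" by (rule degree_power_le)
    also have "\<dots> \<le> 1 * s" by (intro mult_right_mono) (simp_all add: Y_def)
    finally show ?thesis by simp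
  qed
  show "degree R \<le> k - 1"
    unfolding R_def
  proof (intro degree_sum_le)
    fix s assume "s \<in> {..<k}"
    then have "k - Suc s + s \<le> k - 1" by auto
    then show "degree (monom 1 (k - Suc s) * Y ^ s) \<le> k - 1"
      using degree_mult_le[of "monom 1 (k - Suc s)" "Y ^ s"] degree_monom_le[of "1::real" "k - Suc s"] degY[of s]
      by linarith
  qed auto
  have lcY: "coeff (Y ^ s) s = q ^ (2 * s)" for s
  proof (induction s)
    case (Suc s)
    have "coeff (Y ^ Suc s) (Suc s) = q_int q 2 * coeff (Y ^ s) (Suc s) + q ^ 2 * coeff (Y ^ s) s"
      by (simp add: Y_def)
    moreover have "coeff (Y ^ s) (Suc s) = 0"
      using degY[of s] by (intro coeff_eq_0) simp
    ultimately show ?case using Suc by (simp add: power_mult power2_eq_square)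
  qed simp
  have "coeff R (k - 1) = (\<Sum>s<k. q ^ (2 * s))"
    unfolding R_def coeff_sum
  proof (intro sum.cong refl)
    fix s assume "s \<in> {..<k}"
    then have "k - 1 - (k - Suc s) = s" "k - Suc s \<le> k - 1" by auto
    then show "coeff (monom 1 (k - Suc s) * Y ^ s) (k - 1) = q ^ (2 * s)"
      by (simp add: coeff_monom_mult lcY)
  qed
  then show "q_int q 2 * coeff R (k - 1) = q_int q (2 * k)"
    by (simp add: q_int_double)
  fix j
  have a: "q_int q (j + 2) = q_int q j + q ^ j * q_int q 2"
    by (rule q_int_add)
  have b: "q_int q (j + 2) = q_int q 2 + q ^ 2 * q_int q j"
    using q_int_add[of q 2 j] by (simp add: add.commute)
  have "q_int q (j + 2) ^ k - q_int q j ^ k =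
      (q_int q (j + 2) - q_int q j) * (\<Sum>s<k. q_int q j ^ (k - Suc s) * q_int q (j + 2) ^ s)"
    by (rule power_diff_sumr2)
  also have "(\<Sum>s<k. q_int q j ^ (k - Suc s) * q_int q (j + 2) ^ s) = poly R (q_int q j)"
    by (simp add: R_def poly_sum poly_monom b Y_def mult.commute del: add_2_eq_Suc')
  finally show "q_int q (j + 2) ^ k - q_int q j ^ k = q ^ j * q_int q 2 * poly R (q_int q j)"
    by (simp add: a del: add_2_eq_Suc')
qed

text \<open>
  On the left are the two contributions to the coefficient of \<open>x\<^sup>k\<close> for \<open>\<alpha> = 0\<close>, up to the factor
  \<open>[n]\<^sup>k\<close>. After removing common factors the identity says
  \<open>[n-1-k] + q\<^bsup>n-1-k\<^esup> [2k] = [n-1+k]\<close>. The case \<open>k = n\<close> is special, since there \<open>n - 1 - k\<close> is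
  truncated; but then both sides vanish, through a factor \<open>[0]\<close>.
\<close>

lemma diagonal_coeff_identity:
  assumes "q > 0" "2 \<le> k" "k \<le> n"
  shows "q ^ (k * (k - 1) div 2) * (\<Prod>i<k. q_int q (n - 2 - i)) +
     q ^ (n - 2) * q_int q (2 * k) * (q ^ ((k - 1) * (k - 1 - 1) div 2) * (\<Prod>i<k - 1. q_int q (n - 2 - i))) =
     q ^ (k * (k - 1) div 2) * (q_fact q (n - 2) / q_fact q (n - k)) * (q_int q (n - k) * q_int q (n - 1 + k))"
proof -
  define P where "P = (\<Prod>i<k - 1. q_int q (n - 2 - i))"
  have k: "k = Suc (k - 1)" using assms by simp
  have prodk: "(\<Prod>i<k. q_int q (n - 2 - i)) = P * q_int q (n - 2 - (k - 1))"
    by (subst k) (simp only: prod.lessThan_Suc P_def)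
  have expo: "k * (k - 1) div 2 = (k - 1) + (k - 1) * (k - 1 - 1) div 2"
    using triangular_exponent_Suc[of "k - 1"] k by simp
  have fpos: "q_fact q (n - k) > 0" using assms q_fact_pos by simp
  have P: "P = q_fact q (n - 2) / q_fact q (n - k) * q_int q (n - k)"
  proof (cases "k = n")
    case True
    \<comment> \<open>The factor \<open>i = n - 2\<close> of \<open>P\<close> is \<open>[0]\<close>.\<close>
    then have "n - 2 \<in> {..<k - 1}" using assms by auto
    then have "P = 0" unfolding P_def by (intro prod_zero) (auto intro!: bexI[of _ "n - 2"])
    then show ?thesis using True by simp
  next
    case False
    then have e: "n - k = Suc (n - 2 - (k - 1))" and l: "k - 1 \<le> n - 2" using assms by auto
    have "q_fact q (n - k) = q_int q (n - k) * q_fact q (n - 2 - (k - 1))"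
      unfolding e by (rule q_fact_Suc)
    moreover have "q_int q (n - k) > 0" using e assms(1) by (intro q_int_pos) auto
    ultimately show ?thesis
      unfolding P_def prod_q_int_falling[OF l assms(1)] by simp
  qed
  show ?thesis
  proof (cases "k = n")
    case True
    then show ?thesis unfolding prodk P_def[symmetric] using P by simp
  next
    case False
    then have l: "n - 2 = (n - 2 - (k - 1)) + (k - 1)" and e: "n - 1 + k = (n - 2 - (k - 1)) + 2 * k"
      using assms by auto
    have "q_int q (n - 1 + k) = q_int q (n - 2 - (k - 1)) + q ^ (n - 2 - (k - 1)) * q_int q (2 * k)"
      unfolding e by (rule q_int_add)
    moreover have "q ^ (n - 2) = q ^ (n - 2 - (k - 1)) * q ^ (k - 1)"
      using l by (metis power_add)
    ultimately show ?thesis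
      unfolding prodk P_def[symmetric] unfolding P expo power_add
      by (simp add: algebra_simps)
  qed
qed

lemma bernstein_op_power:
  assumes "q > 0" "2 \<le> k" "k \<le> n"
  shows "degree (bernstein_op n q \<alpha> (\<lambda>x. x ^ k)) \<le> k"
    "coeff (bernstein_op n q \<alpha> (\<lambda>x. x ^ k)) k = bernstein_eigenvalue n q \<alpha> k"
proof -
  have n: "n \<ge> 2" and k1: "k \<ge> 1" and k: "k = Suc (k - 1)" using assms by auto
  define N where "N = q_int q n ^ k"
  have N: "N > 0" using assms n by (simp add: N_def q_int_pos)
  obtain R where R: "degree R \<le> k - 1" "q_int q 2 * coeff R (k - 1) = q_int q (2 * k)"
    "\<And>j. q_int q (j + 2) ^ k - q_int q j ^ k = q ^ j * q_int q 2 * poly R (q_int q j)"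
    using q_int_add2_power_diff[OF k1] by metis
  define B where "B m = q_bernstein q m (\<lambda>j. poly (monom 1 k) (q_int q j))" for m
  define H where "H = q_bernstein q (n - 2) (\<lambda>j. poly R (q_int q j))"
  define e where "e = k * (k - 1) div 2"
  define e' where "e' = (k - 1) * (k - 1 - 1) div 2"
  have B: "degree (B m) \<le> k" "coeff (B m) k = q ^ e * (\<Prod>i<k. q_int q (m - i))" for m
    using q_bernstein_poly[OF assms(1) degree_monom_le, of m 1 k] by (simp_all add: B_def e_def)
  have H: "degree H \<le> k - 1" "coeff H (k - 1) = coeff R (k - 1) * q ^ e' * (\<Prod>i<k - 1. q_int q (n - 2 - i))"
    using q_bernstein_poly[OF assms(1) R(1), of "n - 2"] unfolding H_def e'_def by auto
  have Beq: "q_bernstein q m (\<lambda>j. (q_int q j / q_int q n) ^ k) = smult (1 / N) (B m)" for m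
    using q_bernstein_cmult[of q m "1 / N" "\<lambda>j. q_int q j ^ k"]
    by (simp add: B_def N_def poly_monom power_divide)
  \<comment> \<open>The factor \<open>q\<^sup>j\<close> of the difference and the weight \<open>q\<^bsup>n-2-j\<^esup>\<close> multiply to a constant.\<close>
  have "q ^ (n - 2 - j) * ((q_int q (j + 2) / q_int q n) ^ k - (q_int q j / q_int q n) ^ k) =
      q ^ (n - 2) * q_int q 2 / N * poly R (q_int q j)" if "j \<le> n - 2" for j
  proof -
    have "(q_int q (j + 2) / q_int q n) ^ k - (q_int q j / q_int q n) ^ k =
        q ^ j * q_int q 2 * poly R (q_int q j) / N"
      unfolding power_divide diff_divide_distrib[symmetric] R(3) N_def ..
    moreover have "q ^ (n - 2) = q ^ (n - 2 - j) * q ^ j"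
      using that by (metis le_add_diff_inverse2 power_add)
    ultimately show ?thesis by simp
  qed
  then have "q_bernstein q (n - 2) (\<lambda>j. q ^ (n - 2 - j) *
        ((q_int q (j + 2) / q_int q n) ^ k - (q_int q j / q_int q n) ^ k)) =
      smult (q ^ (n - 2) * q_int q 2 / N) H"
    unfolding H_def q_bernstein_cmult[symmetric] by (rule q_bernstein_cong)
  then have T: "bernstein_op n q \<alpha> (\<lambda>x. x ^ k) =
      smult (1 - \<alpha>) (smult (1 / N) (B (n - 2)) + pCons 0 (smult (q ^ (n - 2) * q_int q 2 / N) H))
      + smult \<alpha> (smult (1 / N) (B n))"
    unfolding bernstein_op_decomp[OF n] Beq by simp
  have "degree (smult (q ^ (n - 2) * q_int q 2 / N) H) \<le> k - 1"
    using H(1) degree_smult_le order_trans by blast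
  then have "degree (pCons 0 (smult (q ^ (n - 2) * q_int q 2 / N) H)) \<le> k"
    using k by (metis Suc_le_mono degree_pCons_le order_trans)
  then show "degree (bernstein_op n q \<alpha> (\<lambda>x. x ^ k)) \<le> k"
    unfolding T using B(1) by (intro degree_add_le order_trans[OF degree_smult_le]) auto
  have "coeff (pCons 0 (smult (q ^ (n - 2) * q_int q 2 / N) H)) k = q ^ (n - 2) * q_int q 2 / N * coeff H (k - 1)"
    by (subst k) (simp only: coeff_pCons_Suc coeff_smult)
  also have "\<dots> = q ^ (n - 2) * (q_int q 2 * coeff R (k - 1)) * (q ^ e' * (\<Prod>i<k - 1. q_int q (n - 2 - i))) / N"
    unfolding H(2) by simp
  finally have cH: "coeff (pCons 0 (smult (q ^ (n - 2) * q_int q 2 / N) H)) k =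
      q ^ (n - 2) * q_int q (2 * k) * (q ^ e' * (\<Prod>i<k - 1. q_int q (n - 2 - i))) / N"
    unfolding R(2) .
  have "coeff (bernstein_op n q \<alpha> (\<lambda>x. x ^ k)) k =
      (1 - \<alpha>) * ((q ^ e * (\<Prod>i<k. q_int q (n - 2 - i))
        + q ^ (n - 2) * q_int q (2 * k) * (q ^ e' * (\<Prod>i<k - 1. q_int q (n - 2 - i)))) / N)
      + \<alpha> * (q ^ e * (\<Prod>i<k. q_int q (n - i)) / N)"
    unfolding T coeff_add coeff_smult cH B(2) by (simp add: add_divide_distrib)
  also have "(\<Prod>i<k. q_int q (n - i)) = q_int q n * q_int q (n - 1) * (q_fact q (n - 2) / q_fact q (n - k))"
  proof -
    obtain l where l: "n = Suc (Suc l)" using n by (metis add_2_eq_Suc le_Suc_ex)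
    then show ?thesis
      unfolding prod_q_int_falling[OF assms(3,1)] by (simp add: q_fact_Suc)
  qed
  also have "(1 - \<alpha>) * ((q ^ e * (\<Prod>i<k. q_int q (n - 2 - i))
        + q ^ (n - 2) * q_int q (2 * k) * (q ^ e' * (\<Prod>i<k - 1. q_int q (n - 2 - i)))) / N)
      + \<alpha> * (q ^ e * (q_int q n * q_int q (n - 1) * (q_fact q (n - 2) / q_fact q (n - k))) / N)
      = bernstein_eigenvalue n q \<alpha> k"
    unfolding e_def e'_def diagonal_coeff_identity[OF assms]
    using assms(2) by (simp add: bernstein_eigenvalue_def N_def add_divide_distrib diff_divide_distrib algebra_simps)
  finally show "coeff (bernstein_op n q \<alpha> (\<lambda>x. x ^ k)) k = bernstein_eigenvalue n q \<alpha> k" .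
qed

section \<open>The eigenvalues decrease strictly\<close>

text \<open>
  The closed form extends down to \<open>k = 1\<close>, where it gives \<open>1\<close>. Hence one comparison of
  consecutive terms, starting at \<open>k = 1\<close>, covers the whole chain.
\<close>

lemma bernstein_eigenvalue_formula:
  assumes "q > 0" "n \<ge> 2" "k \<ge> 1"
  shows "bernstein_eigenvalue n q \<alpha> k =
    q ^ (k * (k - 1) div 2) * q_fact q (n - 2) / (q_fact q (n - k) * q_int q n ^ k)
      * ((1 - \<alpha>) * (q_int q (n - k) * q_int q (n - 1 + k)) + \<alpha> * (q_int q n * q_int q (n - 1)))"
proof (cases "k = 1")
  case True
  obtain l where l: "n = Suc (Suc l)" using assms by (metis add_2_eq_Suc le_Suc_ex)
  have "q_int q (Suc (Suc l)) > 0" "q_int q (Suc l) > 0" "q_fact q l > 0"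
    using assms by (simp_all add: q_int_pos q_fact_pos)
  then show ?thesis
    using True by (simp add: l bernstein_eigenvalue_def q_fact_Suc field_simps)
next
  case False
  then show ?thesis
    using assms by (simp add: bernstein_eigenvalue_def mult.assoc)
qed

text \<open>
  Passing from \<open>k\<close> to \<open>k + 1\<close> multiplies the prefactor by \<open>\<rho> = q\<^sup>k [n-k] / [n]\<close>, which is less
  than \<open>1\<close> because \<open>[n] = [k] + q\<^sup>k [n-k]\<close>. The bracket \<open>D k\<close> does not increase, since
  \<open>[a+1] [b] - [a] [b+1] = [b] - [a] \<ge> 0\<close> with \<open>a = n-k-1\<close> and \<open>b = n-1+k\<close>. It is positive for
  \<open>k < n\<close>, so the inequality is strict even if \<open>\<lambda>\<^bsub>k+1\<^esub> = 0\<close>, as happens for \<open>\<alpha> = 0\<close> and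
  \<open>k + 1 = n\<close>.
\<close>

lemma bernstein_eigenvalue_Suc_less:
  assumes "q > 0" "\<alpha> \<in> {0..1}" "1 \<le> k" "k < n"
  shows "bernstein_eigenvalue n q \<alpha> (Suc k) < bernstein_eigenvalue n q \<alpha> k"
proof -
  have n: "n \<ge> 2" using assms by simp
  define D where "D k = (1 - \<alpha>) * (q_int q (n - k) * q_int q (n - 1 + k)) + \<alpha> * (q_int q n * q_int q (n - 1))" for k
  define c where "c = q ^ (k * (k - 1) div 2) * q_fact q (n - 2) / (q_fact q (n - k) * q_int q n ^ k)"
  define \<rho> where "\<rho> = q ^ k * q_int q (n - k) / q_int q n"
  have nk: "n - k = Suc (n - Suc k)" using assms by simp
  have pos: "q_int q n > 0" "q_int q (n - 1) > 0" "q_int q (n - k) > 0" "q_int q (n - 1 + k) > 0"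
    "q_fact q (n - Suc k) > 0"
    using assms by (auto intro!: q_int_pos q_fact_pos)
  have c: "c > 0"
    unfolding c_def using assms(1) pos by (simp add: q_fact_pos)
  have "q_int q n = q_int q k + q ^ k * q_int q (n - k)"
    using q_int_add[of q k "n - k"] assms by simp
  then have \<rho>: "0 \<le> \<rho>" "\<rho> < 1"
    using assms pos q_int_pos[of q k] by (auto simp: \<rho>_def)
  have "q_int q (n - Suc k) * q_int q (n - 1 + Suc k) \<le> q_int q (n - k) * q_int q (n - 1 + k)"
  proof -
    have "q_int q (n - 1 + k) = q_int q (n - Suc k) + q ^ (n - Suc k) * q_int q (2 * k)"
      using q_int_add[of q "n - Suc k" "2 * k"] assms by (simp add: nk add.commute)
    then have "q_int q (n - Suc k) \<le> q_int q (n - 1 + k)"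
      using assms q_int_nonneg[of q "2 * k"] by simp
    then show ?thesis
      using nk by (simp add: q_int_Suc_left algebra_simps)
  qed
  then have D_mono: "D (Suc k) \<le> D k"
    using assms(2) by (simp add: D_def mult_left_mono)
  have D_pos: "D k > 0"
  proof (cases "\<alpha> = 0")
    case True
    then show ?thesis using pos by (simp add: D_def)
  next
    case False
    then have "\<alpha> > 0" "1 - \<alpha> \<ge> 0" using assms(2) by auto
    then show ?thesis using pos by (simp add: D_def add_nonneg_pos)
  qed
  have fk: "q_fact q (n - k) = q_int q (n - k) * q_fact q (n - Suc k)"
    unfolding nk by (rule q_fact_Suc)
  have "bernstein_eigenvalue n q \<alpha> (Suc k) = c * \<rho> * D (Suc k)"
    using assms n pos unfolding bernstein_eigenvalue_formula[OF assms(1) n le_SucI[OF assms(3)]] D_def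
      triangular_exponent_Suc c_def \<rho>_def fk
    by (simp add: power_add mult_ac)
  also have "\<dots> \<le> c * \<rho> * D k"
    using c \<rho> D_mono by (intro mult_left_mono) auto
  also have "\<dots> < c * 1 * D k"
    using c \<rho> D_pos by (intro mult_strict_right_mono mult_strict_left_mono)
  also have "\<dots> = bernstein_eigenvalue n q \<alpha> k"
    unfolding bernstein_eigenvalue_formula[OF assms(1) n assms(3)] by (simp add: c_def D_def)
  finally show ?thesis .
qed

lemma bernstein_eigenvalue_less:
  assumes "q > 0" "\<alpha> \<in> {0..1}" "j < k" "2 \<le> k" "k \<le> n"
  shows "bernstein_eigenvalue n q \<alpha> k < bernstein_eigenvalue n q \<alpha> j"
proof -
  have main: "bernstein_eigenvalue n q \<alpha> k < bernstein_eigenvalue n q \<alpha> i" if "1 \<le> i" "i < k" for i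
    using Suc_leI[OF that(2)] assms(5)
  proof (induction k rule: dec_induct)
    case base
    then show ?case using assms that by (intro bernstein_eigenvalue_Suc_less) auto
  next
    case (step m)
    then show ?case
      using bernstein_eigenvalue_Suc_less[OF assms(1,2), of m n] that by fastforce
  qed
  show ?thesis
  proof (cases "j = 0")
    case True
    then show ?thesis using main[of 1] assms by (simp add: bernstein_eigenvalue_def)
  next
    case False
    then show ?thesis using main[of j] assms by simp
  qed
qed

section \<open>Eigenvectors of triangular operators on polynomials\<close>

text \<open>
  Back substitution: \<open>L - \<mu>\<close> is triangular with nonzero diagonal entries on the polynomials of
  degree below \<open>d\<close>, hence onto. The degree bound is stated through vanishing coefficients
  so that it includes the zero polynomial, also for \<open>d = 0\<close>.
\<close>

lemma triangular_solve:
  fixes L :: "real poly \<Rightarrow> real poly"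
  assumes add: "\<And>p r. L (p + r) = L p + L r" and scale: "\<And>c p. L (smult c p) = smult c (L p)"
    and tri: "\<And>j. j < d \<Longrightarrow> degree (L (monom 1 j)) \<le> j \<and> coeff (L (monom 1 j)) j \<noteq> \<mu>"
    and g: "\<forall>i\<ge>d. coeff g i = 0"
  shows "\<exists>u. (\<forall>i\<ge>d. coeff u i = 0) \<and> L u - smult \<mu> u = g"
  using tri g
proof (induction d arbitrary: g)
  case 0
  then have "g = 0" by (intro poly_eqI) simp
  moreover have "L 0 = 0" using scale[of 0 0] by simp
  ultimately show ?case by (intro exI[of _ 0]) simp
next
  case (Suc d)
  let ?l = "coeff (L (monom 1 d)) d"
  \<comment> \<open>The multiple of \<open>x\<^sup>d\<close> whose image matches \<open>g\<close> in degree \<open>d\<close>.\<close>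
  define c where "c = coeff g d / (?l - \<mu>)"
  define v where "v = smult c (monom 1 d)"
  have ne: "?l - \<mu> \<noteq> 0" and deg: "degree (L (monom 1 d)) \<le> d" using Suc.prems(1)[of d] by auto
  have "coeff (g - (L v - smult \<mu> v)) i = 0" if "i \<ge> d" for i
  proof (cases "i = d")
    case True
    have "c * ?l - \<mu> * c = c * (?l - \<mu>)" by (simp add: algebra_simps)
    also have "\<dots> = coeff g d" using ne by (simp add: c_def)
    finally show ?thesis by (simp add: True v_def scale)
  next
    case False
    then have "i > d" using that by simp
    then show ?thesis using Suc.prems(2) deg by (simp add: v_def scale coeff_eq_0)
  qed
  then obtain u where u: "\<forall>i\<ge>d. coeff u i = 0" "L u - smult \<mu> u = g - (L v - smult \<mu> v)"
    using Suc.IH[of "g - (L v - smult \<mu> v)"] Suc.prems(1) by auto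
  have "L (u + v) - smult \<mu> (u + v) = g"
    using u(2) by (simp add: add smult_add_right algebra_simps)
  moreover have "\<forall>i\<ge>Suc d. coeff (u + v) i = 0"
    using u(1) by (simp add: v_def)
  ultimately show ?case by blast
qed

text \<open>
  The eigenvector is \<open>x\<^sup>k + u\<close>, where \<open>u\<close> has lower degree and solves
  \<open>(L - \<mu>) u = \<mu> x\<^sup>k - L x\<^sup>k\<close>; the right-hand side has degree below \<open>k\<close> because \<open>\<mu>\<close> is the
  diagonal entry.
\<close>

lemma triangular_eigenvector:
  fixes L :: "real poly \<Rightarrow> real poly"
  assumes add: "\<And>p r. L (p + r) = L p + L r" and scale: "\<And>c p. L (smult c p) = smult c (L p)"
    and tri: "\<And>j. j \<le> k \<Longrightarrow> degree (L (monom 1 j)) \<le> j"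
    and ne: "\<And>j. j < k \<Longrightarrow> coeff (L (monom 1 j)) j \<noteq> coeff (L (monom 1 k)) k"
  shows "\<exists>p. degree p = k \<and> lead_coeff p = 1 \<and> L p = smult (coeff (L (monom 1 k)) k) p"
proof -
  define \<mu> where "\<mu> = coeff (L (monom 1 k)) k"
  define M where "M = monom (1::real) k"
  have "\<forall>i\<ge>k. coeff (smult \<mu> M - L M) i = 0"
  proof (intro allI impI)
    fix i assume "k \<le> i"
    then show "coeff (smult \<mu> M - L M) i = 0"
      using tri[of k] by (cases "i = k") (auto simp: M_def \<mu>_def coeff_eq_0)
  qed
  moreover have "degree (L (monom 1 j)) \<le> j \<and> coeff (L (monom 1 j)) j \<noteq> \<mu>" if "j < k" for j
    using that tri[of j] ne[of j] by (simp add: \<mu>_def)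
  ultimately obtain u where u: "\<forall>i\<ge>k. coeff u i = 0" "L u - smult \<mu> u = smult \<mu> M - L M"
    using triangular_solve[of L k \<mu> "smult \<mu> M - L M", OF add scale] by blast
  have "coeff (u + M) k = 1" using u(1) by (simp add: M_def)
  moreover have "degree (u + M) \<le> k"
    using u(1) by (intro degree_le) (auto simp: M_def)
  ultimately have "degree (u + M) = k"
    by (metis le_antisym le_degree zero_neq_one)
  moreover have "L (u + M) = smult \<mu> (u + M)"
    using u(2) by (simp add: add smult_add_right algebra_simps)
  ultimately show ?thesis
    using \<open>coeff (u + M) k = 1\<close> \<mu>_def by blast
qed

lemma independent_distinct_degrees:
  fixes p :: "nat \<Rightarrow> real poly"
  assumes "\<And>k. k < N \<Longrightarrow> degree (p k) = k \<and> p k \<noteq> 0"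
  shows "poly_vs.independent (p ` {..<N})"
  using assms
proof (induction N)
  case 0
  then show ?case by (simp add: poly_vs.independent_empty)
next
  case (Suc N)
  have "poly_vs.span (p ` {..<N}) \<subseteq> {r. \<forall>i\<ge>N. coeff r i = 0}"
    using Suc.prems
    by (intro poly_vs.span_minimal) (auto simp: poly_vs.subspace_def coeff_eq_0)
  moreover have "coeff (p N) N \<noteq> 0"
    using Suc.prems[of N] leading_coeff_neq_0 by fastforce
  ultimately have "p N \<notin> poly_vs.span (p ` {..<N})"
    by auto
  then show ?case
    using Suc by (simp add: lessThan_Suc poly_vs.independent_insertI)
qed

text \<open>
  For \<open>k = 1\<close> the general construction is blocked by \<open>\<lambda>\<^sub>0 = \<lambda>\<^sub>1\<close>, and the fixed polynomial
  \<open>x\<close> is used instead.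
\<close>

lemma bernstein_eigenvector_exists:
  assumes "q > 0" "\<alpha> \<in> {0..1}" "n \<ge> 1" "k \<le> n"
  shows "\<exists>p. degree p = k \<and> lead_coeff p = 1 \<and>
    bernstein_eigenvector n q \<alpha> (bernstein_eigenvalue n q \<alpha> k) p"
proof (cases "k = 1")
  case True
  have "poly [:0, 1::real:] = (\<lambda>x. x)"
    by (intro ext) simp
  then have "bernstein_op n q \<alpha> (poly [:0, 1:]) = [:0, 1:]"
    by (simp only: bernstein_op_id[OF assms(1,3)])
  then show ?thesis
    using True
    by (intro exI[of _ "[:0, 1:]"]) (simp add: bernstein_eigenvector_def bernstein_eigenvalue_def)
next
  case False
  define L where "L p = bernstein_op n q \<alpha> (poly p)" for p
  have L_add: "L (p + r) = L p + L r" for p r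
    by (simp add: L_def bernstein_op_def smult_add_left sum.distrib)
  have L_smult: "L (smult c p) = smult c (L p)" for c p
    by (simp add: L_def bernstein_op_def smult_sum_right)
  have "poly (monom 1 j) = (\<lambda>x::real. x ^ j)" for j
    by (intro ext) (simp add: poly_monom)
  then have L_monom_eq: "L (monom 1 j) = bernstein_op n q \<alpha> (\<lambda>x. x ^ j)" for j
    by (simp add: L_def)
  have L_monom: "degree (L (monom 1 j)) \<le> j \<and> coeff (L (monom 1 j)) j = bernstein_eigenvalue n q \<alpha> j"
    if "j \<le> n" for j
  proof -
    consider "j = 0" | "j = 1" | "j \<ge> 2" by linarith
    then show ?thesis
    proof cases
      case 1
      then show ?thesis using bernstein_op_one[OF assms(1,3), of \<alpha>]
        by (simp only: L_monom_eq) (simp add: bernstein_eigenvalue_def)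
    next
      case 2
      then show ?thesis using bernstein_op_id[OF assms(1,3), of \<alpha>]
        by (simp only: L_monom_eq) (simp add: bernstein_eigenvalue_def)
    next
      case 3
      then show ?thesis using bernstein_op_power[OF assms(1) 3 that, of \<alpha>]
        by (simp add: L_monom_eq)
    qed
  qed
  have "\<exists>p. degree p = k \<and> lead_coeff p = 1 \<and> L p = smult (coeff (L (monom 1 k)) k) p"
  proof (rule triangular_eigenvector)
    fix j assume "j < k"
    then have "bernstein_eigenvalue n q \<alpha> k < bernstein_eigenvalue n q \<alpha> j"
      using False assms by (intro bernstein_eigenvalue_less) auto
    then show "coeff (L (monom 1 j)) j \<noteq> coeff (L (monom 1 k)) k"
      using L_monom[of j] L_monom[of k] \<open>j < k\<close> assms by simp
  qed (use L_monom assms in \<open>auto simp: L_add L_smult\<close>)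
  then obtain p where "degree p = k" "lead_coeff p = 1" "L p = smult (bernstein_eigenvalue n q \<alpha> k) p"
    using L_monom[of k] assms by auto
  then show ?thesis
    by (intro exI[of _ p]) (auto simp: bernstein_eigenvector_def L_def)
qed

theorem lemma4p1:
  fixes q \<alpha> :: real and n :: nat
  assumes "q > 0" and "\<alpha> \<in> {0..1}" and "n \<ge> 1"
  shows "\<exists>p :: nat \<Rightarrow> real poly.
    inj_on p {0..n} \<and> poly_vs.independent (p ` {0..n}) \<and>
    (\<forall>k\<in>{0..n}. degree (p k) = k \<and> lead_coeff (p k) = 1 \<and>
       bernstein_eigenvector n q \<alpha> (bernstein_eigenvalue n q \<alpha> k) (p k))"
proof -
  have "\<forall>k\<in>{0..n}. \<exists>p. degree p = k \<and> lead_coeff p = 1 \<and>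
      bernstein_eigenvector n q \<alpha> (bernstein_eigenvalue n q \<alpha> k) p"
    using bernstein_eigenvector_exists[OF assms] by simp
  then obtain p where p: "\<forall>k\<in>{0..n}. degree (p k) = k \<and> lead_coeff (p k) = 1 \<and>
      bernstein_eigenvector n q \<alpha> (bernstein_eigenvalue n q \<alpha> k) (p k)"
    by metis
  have "inj_on p {0..n}"
    using p by (metis inj_onI)
  moreover have "{0..n} = {..<Suc n}"
    by auto
  then have "poly_vs.independent (p ` {0..n})"
    using p independent_distinct_degrees[of "Suc n" p]
    by (auto simp: bernstein_eigenvector_def)
  ultimately show ?thesis using p by blast
qed

end
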